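(* Let $G$ be a finite group and let $(\Gamma,\Psi)$ be a $G$-gain graph. Then the adjacency matrix of the cover graph $L(\Gamma,\Psi)$ is $A_{\lambda_G}$, i.e. the Fourier transform $\widehat{A}(\lambda_G)$ of the adjacency matrix $A$ of $(\Gamma,\Psi)$ at the left regular representation $\lambda_G$.
   Context: $\Gamma=(V_\Gamma,E_\Gamma)$ is a finite simple graph (no loops, no multiple edges) whose edges are regarded as ordered pairs, with $(v,u)\in E_\Gamma$ if and only if $(u,v)\in E_\Gamma$. A $G$-gain function is a map $\Psi\colon E_\Gamma\to G$ with $\Psi(u,v)=\Psi(v,u)^{-1}$; the pair $(\Gamma,\Psi)$ is a $G$-gain graph. Fix orders $v_1,\dots,v_n$ of $V_\Gamma$ and $g_1,\dots,g_k$ of $G$. The adjacency matrix $A\in M_n(\mathbb{C}G)$ of $(\Gamma,\Psi)$ (entries in the group algebra $\mathbb{C}G$) has $(i,j)$ entry $\Psi(v_i,v_j)$ if $(v_i,v_j)\in E_\Gamma$ and $0$ otherwise. For $F\in M_n(\mathbb{C}G)$ and $x\in G$, let $F(x)\in M_n(\mathbb{C})$ be the matrix whose $(i,j)$ entry is the coefficient of $x$ in $F_{i,j}$. The Fourier transform of $F$ at a representation $\pi\colon G\to GL_m(\mathbb{C})$ is $\widehat{F}(\pi)=\sum_{x\in G}F(x)\otimes\pi(x)\in M_{nm}(\mathbb{C})$, where $\otimes$ is the Kronecker product, $(B\otimes C)_{m(i-1)+r,\,m(j-1)+p}=B_{i,j}C_{r,p}$ for $C$ of size $m$. Put $A_\pi=\widehat{A}(\pi)$.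 The left regular representation $\lambda_G$ of $G$ acts on $\mathbb{C}G$ by left multiplication; in the basis $g_1,\dots,g_k$, $\lambda_G(g)_{r,p}=1$ if $g=g_rg_p^{-1}$ and $0$ otherwise. The cover graph $L(\Gamma,\Psi)$ is the non-oriented graph with vertex set $V_\Gamma\times G$ such that $(u,g)\sim(v,h)$ if and only if $(u,v)\in E_\Gamma$ and $h=\Psi(u,v)^{-1}g$. Its adjacency matrix is taken with respect to the lexicographic order $(v_1,g_1),(v_1,g_2),\dots,(v_n,g_{k-1}),(v_n,g_k)$ of the vertices. *)

theory Defs
  imports
    "Graph_Theory.Pair_Digraph"
    "Jordan_Normal_Form.Matrix"
    "HOL-Algebra.Coset"
    Complex_Main
begin

section \<open>Gain graphs and their covers\<close>

text \<open>A finite simple graph with edges regarded as ordered pairs is a \<^locale>\<open>pair_graph\<close>: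
  finite, loopless, with a symmetric set \<^const>\<open>parcs\<close> of arcs.\<close>

definition gain_graph ::
  "('g, 'b) monoid_scheme \<Rightarrow> 'v pair_pre_digraph \<Rightarrow> ('v \<times> 'v \<Rightarrow> 'g) \<Rightarrow> bool" where
  "gain_graph G \<Gamma> \<Psi> \<longleftrightarrow>
     pair_graph \<Gamma> \<and>
     \<Psi> \<in> parcs \<Gamma> \<rightarrow> carrier G \<and>
     (\<forall>(u, v) \<in> parcs \<Gamma>. \<Psi> (u, v) = inv\<^bsub>G\<^esub> \<Psi> (v, u))"

definition cover_graph ::
  "('g, 'b) monoid_scheme \<Rightarrow> 'v pair_pre_digraph \<Rightarrow> ('v \<times> 'v \<Rightarrow> 'g) \<Rightarrow> ('v \<times> 'g) pair_pre_digraph"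
  where
  "cover_graph G \<Gamma> \<Psi> =
     \<lparr> pverts = pverts \<Gamma> \<times> carrier G,
       parcs = {((u, g), (v, h)) | u g v h.
                  g \<in> carrier G \<and> h \<in> carrier G \<and> (u, v) \<in> parcs \<Gamma> \<and>
                  h = inv\<^bsub>G\<^esub> \<Psi> (u, v) \<otimes>\<^bsub>G\<^esub> g} \<rparr>"

definition adjacency_matrix :: "'v pair_pre_digraph \<Rightarrow> 'v list \<Rightarrow> complex mat" where
  "adjacency_matrix \<Gamma> vs =
     mat (length vs) (length vs) (\<lambda>(i, j). if (vs ! i, vs ! j) \<in> parcs \<Gamma> then 1 else 0)"

section \<open>The group algebra\<close>

text \<open>For a finite group, an element of the group algebra is identified with its coefficient
  function, extended by 0 outside the carrier.\<close>

definition group_algebra :: "('g, 'b) monoid_scheme \<Rightarrow> ('g \<Rightarrow> complex) ring" where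
  "group_algebra G =
     \<lparr> carrier = {f. \<forall>x. x \<notin> carrier G \<longrightarrow> f x = 0},
       monoid.mult = (\<lambda>f h x. if x \<in> carrier G
          then (\<Sum>y\<in>carrier G. f y * h (inv\<^bsub>G\<^esub> y \<otimes>\<^bsub>G\<^esub> x)) else 0),
       one = (\<lambda>x. if x = \<one>\<^bsub>G\<^esub> then 1 else 0),
       zero = (\<lambda>x. 0),
       add = (\<lambda>f h x. f x + h x) \<rparr>"

definition group_elem :: "'g \<Rightarrow> 'g \<Rightarrow> complex" where
  "group_elem g = (\<lambda>x. if x = g then 1 else 0)"

definition gain_adjacency_matrix ::
  "('g, 'b) monoid_scheme \<Rightarrow> 'v pair_pre_digraph \<Rightarrow> ('v \<times> 'v \<Rightarrow> 'g) \<Rightarrow> 'v list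
     \<Rightarrow> ('g \<Rightarrow> complex) mat" where
  "gain_adjacency_matrix G \<Gamma> \<Psi> vs =
     mat (length vs) (length vs) (\<lambda>(i, j).
       if (vs ! i, vs ! j) \<in> parcs \<Gamma> then group_elem (\<Psi> (vs ! i, vs ! j))
       else \<zero>\<^bsub>group_algebra G\<^esub>)"

section \<open>Representations and the Fourier transform\<close>

definition representation ::
  "('g, 'b) monoid_scheme \<Rightarrow> nat \<Rightarrow> ('g \<Rightarrow> complex mat) \<Rightarrow> bool" where
  "representation G m \<pi> \<longleftrightarrow> \<pi> \<in> hom G (units_of (ring_mat TYPE(complex) m ()))"

definition left_regular :: "('g, 'b) monoid_scheme \<Rightarrow> 'g list \<Rightarrow> 'g \<Rightarrow> complex mat" where
  "left_regular G gs g =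
     mat (length gs) (length gs)
       (\<lambda>(r, p). if g = gs ! r \<otimes>\<^bsub>G\<^esub> inv\<^bsub>G\<^esub> (gs ! p) then 1 else 0)"

text \<open>With indices counted from 0, the row \<open>m * i + r\<close> (where \<open>r < m\<close>) of the product is indexed by
  the row \<open>i\<close> of the first factor and the row \<open>r\<close> of the second; likewise for columns.\<close>

definition kronecker :: "complex mat \<Rightarrow> complex mat \<Rightarrow> complex mat" where
  "kronecker B C =
     mat (dim_row B * dim_row C) (dim_col B * dim_col C) (\<lambda>(a, b).
       B $$ (a div dim_row C, b div dim_col C) * C $$ (a mod dim_row C, b mod dim_col C))"

definition coeff_matrix :: "('g \<Rightarrow> complex) mat \<Rightarrow> 'g \<Rightarrow> complex mat" where
  "coeff_matrix F x = map_mat (\<lambda>f. f x) F"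

text \<open>Here \<open>m\<close> is the degree of \<open>\<pi>\<close>. The matrix type has no zero independent of the
  dimension, so the sum is the one of the module of matrices of the appropriate size.\<close>

definition fourier_transform ::
  "('g, 'b) monoid_scheme \<Rightarrow> ('g \<Rightarrow> complex) mat \<Rightarrow> nat \<Rightarrow> ('g \<Rightarrow> complex mat) \<Rightarrow> complex mat"
  where
  "fourier_transform G F m \<pi> =
     finsum (module_mat TYPE(complex) (dim_row F * m) (dim_col F * m))
       (\<lambda>x. kronecker (coeff_matrix F x) (\<pi> x)) (carrier G)"

section \<open>The definitions fit together\<close>

lemma pair_graph_cover_graph:
  assumes "group G" "finite (carrier G)" "gain_graph G \<Gamma> \<Psi>"
  shows "pair_graph (cover_graph G \<Gamma> \<Psi>)"
proof -
  interpret group G by fact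
  interpret \<Gamma>: pair_graph \<Gamma> using assms(3) by (simp add: gain_graph_def)
  have fin: "finite (pverts \<Gamma> \<times> carrier G)"
    using assms(2) \<Gamma>.pair_finite_verts by simp
  have sub: "parcs (cover_graph G \<Gamma> \<Psi>) \<subseteq> (pverts \<Gamma> \<times> carrier G) \<times> (pverts \<Gamma> \<times> carrier G)"
    by (auto simp: cover_graph_def dest: \<Gamma>.in_arcsD1 \<Gamma>.in_arcsD2)
  have sym\<Gamma>: "(v, u) \<in> parcs \<Gamma>" if "(u, v) \<in> parcs \<Gamma>" for u v
    using \<Gamma>.pair_sym_arcs that by (auto simp: symmetric_def sym_def)
  have "((v, h), (u, g)) \<in> parcs (cover_graph G \<Gamma> \<Psi>)"
    if "((u, g), (v, h)) \<in> parcs (cover_graph G \<Gamma> \<Psi>)" for u g v h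
  proof -
    from that have e: "(u, v) \<in> parcs \<Gamma>" and g: "g \<in> carrier G" and h: "h \<in> carrier G"
      and hg: "h = inv\<^bsub>G\<^esub> \<Psi> (u, v) \<otimes>\<^bsub>G\<^esub> g"
      by (auto simp: cover_graph_def)
    have c: "\<Psi> (u, v) \<in> carrier G" using e assms(3) by (auto simp: gain_graph_def)
    have "\<Psi> (v, u) = inv\<^bsub>G\<^esub> \<Psi> (u, v)"
      using sym\<Gamma>[OF e] assms(3) by (auto simp: gain_graph_def)
    then have "g = inv\<^bsub>G\<^esub> \<Psi> (v, u) \<otimes>\<^bsub>G\<^esub> h"
      using c g hg by (simp add: m_assoc[symmetric])
    then show ?thesis using sym\<Gamma>[OF e] g h by (simp add: cover_graph_def)
  qed
  then have "symmetric (with_proj (cover_graph G \<Gamma> \<Psi>))"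
    by (auto simp: symmetric_def sym_def)
  moreover have "fst e \<noteq> snd e" if "e \<in> parcs (cover_graph G \<Gamma> \<Psi>)" for e
    using that \<Gamma>.pair_no_loops by (fastforce simp: cover_graph_def)
  moreover have "finite (parcs (cover_graph G \<Gamma> \<Psi>))"
    using finite_subset[OF sub] fin by simp
  ultimately show ?thesis
    using fin
    by unfold_locales
      (auto simp: cover_graph_def dest: \<Gamma>.in_arcsD1 \<Gamma>.in_arcsD2)
qed

lemma gain_adjacency_matrix_closed:
  assumes "gain_graph G \<Gamma> \<Psi>" "i < length vs" "j < length vs"
  shows "gain_adjacency_matrix G \<Gamma> \<Psi> vs $$ (i, j) \<in> carrier (group_algebra G)"
  using assms
  by (auto simp: gain_adjacency_matrix_def group_algebra_def group_elem_def gain_graph_def)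

text \<open>The matrices \<open>left_regular G gs g\<close> describe left multiplication by \<open>g\<close> in the group algebra
  with respect to the basis \<open>gs\<close>, and form a representation.\<close>

lemma left_regular_action:
  assumes "group G" "finite (carrier G)" "set gs = carrier G" "g \<in> carrier G"
    and "r < length gs" "p < length gs"
  shows "left_regular G gs g $$ (r, p) =
    (group_elem g \<otimes>\<^bsub>group_algebra G\<^esub> group_elem (gs ! p)) (gs ! r)"
proof -
  interpret group G by fact
  have r: "gs ! r \<in> carrier G" and p: "gs ! p \<in> carrier G"
    using assms nth_mem by blast+
  have "(group_elem g \<otimes>\<^bsub>group_algebra G\<^esub> group_elem (gs ! p)) (gs ! r)
      = (\<Sum>y\<in>carrier G. if y = g then group_elem (gs ! p) (inv\<^bsub>G\<^esub> y \<otimes>\<^bsub>G\<^esub> gs ! r) else 0)"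
    using r by (auto simp: group_algebra_def group_elem_def intro!: sum.cong)
  also have "\<dots> = group_elem (gs ! p) (inv\<^bsub>G\<^esub> g \<otimes>\<^bsub>G\<^esub> gs ! r)"
    using assms by simp
  also have "\<dots> = left_regular G gs g $$ (r, p)"
  proof -
    have "inv\<^bsub>G\<^esub> g \<otimes>\<^bsub>G\<^esub> gs ! r = gs ! p \<longleftrightarrow> g = gs ! r \<otimes>\<^bsub>G\<^esub> inv\<^bsub>G\<^esub> (gs ! p)"
      using r p assms(4) by (metis inv_closed inv_solve_left inv_solve_right)
    then show ?thesis using assms by (simp add: group_elem_def left_regular_def)
  qed
  finally show ?thesis by simp
qed

lemma left_regular_mult:
  assumes "group G" "distinct gs" "set gs = carrier G" "g \<in> carrier G" "h \<in> carrier G"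
  shows "left_regular G gs (g \<otimes>\<^bsub>G\<^esub> h) = left_regular G gs g * left_regular G gs h"
proof (rule eq_matI)
  interpret group G by fact
  let ?k = "length gs"
  fix r p
  assume "r < dim_row (left_regular G gs g * left_regular G gs h)"
    and "p < dim_col (left_regular G gs g * left_regular G gs h)"
  then have rp: "r < ?k" "p < ?k" by (auto simp: left_regular_def)
  have in_G: "gs ! q \<in> carrier G" if "q < ?k" for q using assms(3) that nth_mem by blast
  have "h \<otimes>\<^bsub>G\<^esub> gs ! p \<in> set gs" using assms in_G rp by simp
  then obtain q0 where q0: "q0 < ?k" "gs ! q0 = h \<otimes>\<^bsub>G\<^esub> gs ! p" by (auto simp: in_set_conv_nth)
  have iff: "h = gs ! q \<otimes>\<^bsub>G\<^esub> inv\<^bsub>G\<^esub> (gs ! p) \<longleftrightarrow> q = q0" if "q < ?k" for q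
  proof -
    have "h = gs ! q \<otimes>\<^bsub>G\<^esub> inv\<^bsub>G\<^esub> (gs ! p) \<longleftrightarrow> gs ! q = gs ! q0"
      using in_G that rp q0 assms(5) by (metis inv_solve_right')
    also have "\<dots> \<longleftrightarrow> q = q0"
      using assms(2) that q0(1) by (rule nth_eq_iff_index_eq)
    finally show ?thesis .
  qed
  have "(left_regular G gs g * left_regular G gs h) $$ (r, p) =
     (\<Sum>q = 0..<?k. (if g = gs ! r \<otimes>\<^bsub>G\<^esub> inv\<^bsub>G\<^esub> (gs ! q) then 1 else 0) *
        (if h = gs ! q \<otimes>\<^bsub>G\<^esub> inv\<^bsub>G\<^esub> (gs ! p) then 1 else 0))"
    using rp by (simp add: left_regular_def scalar_prod_def)
  also have "\<dots> = (\<Sum>q = 0..<?k. if q = q0 then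
        (if g = gs ! r \<otimes>\<^bsub>G\<^esub> inv\<^bsub>G\<^esub> (gs ! q) then 1 else 0) else 0)"
    by (rule sum.cong) (auto simp: iff)
  also have "\<dots> = (if g = gs ! r \<otimes>\<^bsub>G\<^esub> inv\<^bsub>G\<^esub> (gs ! q0) then 1 else 0)"
    using q0(1) by simp
  also have "g = gs ! r \<otimes>\<^bsub>G\<^esub> inv\<^bsub>G\<^esub> (gs ! q0) \<longleftrightarrow>
      g \<otimes>\<^bsub>G\<^esub> h = gs ! r \<otimes>\<^bsub>G\<^esub> inv\<^bsub>G\<^esub> (gs ! p)"
    using q0 rp in_G assms(4,5) by (metis inv_solve_right' m_assoc m_closed)
  finally show "left_regular G gs (g \<otimes>\<^bsub>G\<^esub> h) $$ (r, p) =
      (left_regular G gs g * left_regular G gs h) $$ (r, p)"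
    using rp by (simp add: left_regular_def)
qed (auto simp: left_regular_def)

lemma left_regular_one:
  assumes "group G" "distinct gs" "set gs = carrier G"
  shows "left_regular G gs \<one>\<^bsub>G\<^esub> = 1\<^sub>m (length gs)"
proof (rule eq_matI)
  interpret group G by fact
  fix r p
  assume "r < dim_row (1\<^sub>m (length gs))" "p < dim_col (1\<^sub>m (length gs))"
  then have rp: "r < length gs" "p < length gs" by auto
  then have "gs ! r \<in> carrier G" "gs ! p \<in> carrier G" using assms(3) nth_mem by blast+
  then have "\<one>\<^bsub>G\<^esub> = gs ! r \<otimes>\<^bsub>G\<^esub> inv\<^bsub>G\<^esub> (gs ! p) \<longleftrightarrow> r = p"
    using assms(2) rp by (auto simp: inv_solve_right nth_eq_iff_index_eq)
  then show "left_regular G gs \<one>\<^bsub>G\<^esub> $$ (r, p) = 1\<^sub>m (length gs) $$ (r, p)"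
    using rp by (simp add: left_regular_def)
qed (auto simp: left_regular_def)

lemma representation_left_regular:
  assumes "group G" "distinct gs" "set gs = carrier G"
  shows "representation G (order G) (left_regular G gs)"
proof -
  interpret group G by fact
  let ?M = "ring_mat TYPE(complex) (order G) ()"
  have len: "length gs = order G"
    using assms distinct_card by (fastforce simp: order_def)
  have clo: "left_regular G gs g \<in> carrier ?M" for g
    by (simp add: ring_mat_simps left_regular_def len)
  have "left_regular G gs g \<in> Units ?M" if "g \<in> carrier G" for g
  proof -
    have "left_regular G gs g * left_regular G gs (inv\<^bsub>G\<^esub> g) = 1\<^sub>m (order G)"
      "left_regular G gs (inv\<^bsub>G\<^esub> g) * left_regular G gs g = 1\<^sub>m (order G)"
      using that assms
      by (simp_all add: left_regular_mult[symmetric] left_regular_one len)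
    then show ?thesis using clo by (auto simp: Units_def ring_mat_simps)
  qed
  then show ?thesis
    using assms
    by (auto simp: representation_def hom_def units_of_def ring_mat_simps left_regular_mult)
qed

end

theory Submission
  imports Defs
begin

text \<open>Rows and columns of both matrices are indexed by pairs of a vertex and a group element
  in lexicographic order, so they can be compared entry by entry. At row \<open>(u, g)\<close> and
  column \<open>(v, h)\<close> the Fourier transform sums, over all \<open>x\<close> in the group,
  the coefficient of \<open>x\<close> in the gain matrix at \<open>(u, v)\<close> times the regular
  representation of \<open>x\<close> at \<open>(g, h)\<close>. On an arc the first factor is the
  indicator of \<open>x = \<Psi> (u, v)\<close> and the second that of \<open>x = g h^-1\<close>.
  The sum is therefore 1 if \<open>\<Psi> (u, v) = g h^-1\<close>, that is
  \<open>h = \<Psi> (u, v)^-1 g\<close>, which is adjacency in the cover, and 0 otherwise; off the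
  arcs both entries vanish. The entry formula is \<open>index_fourier_transform\<close>, which rests
  on \<open>index_finsum_module_mat\<close>.\<close>

lemma finsum_module_mat_closed:
  fixes M :: "'x \<Rightarrow> 'a :: comm_ring_1 mat"
  assumes "\<And>x. x \<in> S \<Longrightarrow> M x \<in> carrier_mat nr nc"
  shows "finsum (module_mat TYPE('a) nr nc) M S \<in> carrier_mat nr nc"
proof -
  interpret abelian_group "module_mat TYPE('a) nr nc" by (rule abelian_group_mat)
  show ?thesis using finsum_closed[of M S] assms by (auto simp: module_mat_simps)
qed

text \<open>Addition in the module of matrices of a fixed size is entrywise, so induction on the
  finite index set turns the abstract \<open>finsum\<close> into an ordinary sum of complex numbers
  when applied below.\<close>

lemma index_finsum_module_mat:
  fixes M :: "'x \<Rightarrow> 'a :: comm_ring_1 mat"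
  assumes "finite S" "\<And>x. x \<in> S \<Longrightarrow> M x \<in> carrier_mat nr nc" "a < nr" "b < nc"
  shows "finsum (module_mat TYPE('a) nr nc) M S $$ (a, b) = (\<Sum>x\<in>S. M x $$ (a, b))"
  using assms(1,2)
proof (induction S rule: finite_induct)
  case empty
  interpret abelian_group "module_mat TYPE('a) nr nc" by (rule abelian_group_mat)
  show ?case using assms(3,4) by (simp add: module_mat_simps)
next
  case (insert x S)
  interpret abelian_group "module_mat TYPE('a) nr nc" by (rule abelian_group_mat)
  \<comment> \<open>The entry of a matrix sum is determined only within the dimensions of the second
    summand, so these must be known first.\<close>
  have S: "finsum (module_mat TYPE('a) nr nc) M S \<in> carrier_mat nr nc"
    using insert.prems by (intro finsum_module_mat_closed) auto
  have "finsum (module_mat TYPE('a) nr nc) M (insert x S)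
      = M x + finsum (module_mat TYPE('a) nr nc) M S"
    using insert.hyps insert.prems finsum_insert[of S x M] by (auto simp: module_mat_simps)
  then show ?case using insert S assms(3,4) by auto
qed

lemma kronecker_closed:
  assumes "B \<in> carrier_mat n n'" "C \<in> carrier_mat m m'"
  shows "kronecker B C \<in> carrier_mat (n * m) (n' * m')"
  using assms by (auto simp: kronecker_def)

lemma fourier_transform_closed:
  assumes "F \<in> carrier_mat n n'" "\<And>x. x \<in> carrier G \<Longrightarrow> \<pi> x \<in> carrier_mat m m"
  shows "fourier_transform G F m \<pi> \<in> carrier_mat (n * m) (n' * m)"
proof -
  have "finsum (module_mat TYPE(complex) (n * m) (n' * m))
      (\<lambda>x. kronecker (coeff_matrix F x) (\<pi> x)) (carrier G) \<in> carrier_mat (n * m) (n' * m)"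
    using assms by (intro finsum_module_mat_closed kronecker_closed) (auto simp: coeff_matrix_def)
  then show ?thesis using assms(1) by (simp add: fourier_transform_def)
qed

text \<open>Each Kronecker factor is made of blocks of size \<open>m\<close>: the quotient by
  \<open>m\<close> selects the block, hence an entry of \<open>F\<close>, and the remainder selects
  the position inside it, hence an entry of the representation.\<close>

lemma index_fourier_transform:
  assumes "finite (carrier G)" "F \<in> carrier_mat n n'"
    and "\<And>x. x \<in> carrier G \<Longrightarrow> \<pi> x \<in> carrier_mat m m"
    and "a < n * m" "b < n' * m"
  shows "fourier_transform G F m \<pi> $$ (a, b) =
    (\<Sum>x\<in>carrier G. (F $$ (a div m, b div m)) x * \<pi> x $$ (a mod m, b mod m))"
proof -
  have F: "coeff_matrix F x \<in> carrier_mat n n'" for x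
    using assms(2) by (simp add: coeff_matrix_def)
  have ab: "a div m < n" "b div m < n'"
    using assms(4,5) by (simp_all add: less_mult_imp_div_less)
  have "fourier_transform G F m \<pi> $$ (a, b) =
      (\<Sum>x\<in>carrier G. kronecker (coeff_matrix F x) (\<pi> x) $$ (a, b))"
    using assms F unfolding fourier_transform_def
    by (subst index_finsum_module_mat) (auto intro: kronecker_closed)
  also have "\<dots> = (\<Sum>x\<in>carrier G. (F $$ (a div m, b div m)) x * \<pi> x $$ (a mod m, b mod m))"
  proof (rule sum.cong[OF refl])
    fix x assume "x \<in> carrier G"
    then have "\<pi> x \<in> carrier_mat m m" by (rule assms(3))
    then show "kronecker (coeff_matrix F x) (\<pi> x) $$ (a, b) =
        (F $$ (a div m, b div m)) x * \<pi> x $$ (a mod m, b mod m)"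
      using assms(2,4,5) ab by (simp add: kronecker_def coeff_matrix_def)
  qed
  finally show ?thesis .
qed

theorem lemma4:
  fixes G :: "('g, 'b) monoid_scheme"
    and \<Gamma> :: "'v pair_pre_digraph"
    and \<Psi> :: "'v \<times> 'v \<Rightarrow> 'g"
    and vs :: "'v list"
    and gs :: "'g list"
  assumes "group G" and "finite (carrier G)"
    and "gain_graph G \<Gamma> \<Psi>"
    and "distinct vs" and "set vs = pverts \<Gamma>"
    and "distinct gs" and "set gs = carrier G"
  shows "adjacency_matrix (cover_graph G \<Gamma> \<Psi>) (List.product vs gs) =
         fourier_transform G (gain_adjacency_matrix G \<Gamma> \<Psi> vs) (order G) (left_regular G gs)"
    (is "?L = ?R")
proof (rule eq_matI)
  interpret group G by fact
  let ?n = "length vs" and ?k = "length gs"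
  let ?A = "gain_adjacency_matrix G \<Gamma> \<Psi> vs"
  have k: "order G = ?k"
    using assms(6,7) distinct_card by (fastforce simp: order_def)
  have A: "?A \<in> carrier_mat ?n ?n"
    by (simp add: gain_adjacency_matrix_def)
  have reg: "left_regular G gs x \<in> carrier_mat ?k ?k" for x
    by (simp add: left_regular_def)
  have R: "?R \<in> carrier_mat (?n * ?k) (?n * ?k)"
    unfolding k using A reg by (rule fourier_transform_closed)
  then show "dim_row ?L = dim_row ?R" "dim_col ?L = dim_col ?R"
    by (simp_all add: adjacency_matrix_def)
  fix a b
  assume "a < dim_row ?R" "b < dim_col ?R"
  then have ab: "a < ?n * ?k" "b < ?n * ?k" using R by auto
  \<comment> \<open>With \<open>?k = 0\<close> there would be no index below \<open>?n * ?k\<close>;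
    positivity keeps the remainders modulo \<open>?k\<close> in range.\<close>
  then have k0: "0 < ?k" by (cases "?k = 0") auto
  \<comment> \<open>Position \<open>a\<close> of \<open>List.product vs gs\<close> holds
    \<open>(u, g)\<close> and position \<open>b\<close> holds \<open>(v, h)\<close>: the
    lexicographic order splits indices exactly as the Kronecker product does.\<close>
  define u g v h where "u = vs ! (a div ?k)" and "g = gs ! (a mod ?k)"
    and "v = vs ! (b div ?k)" and "h = gs ! (b mod ?k)"
  note uv = u_def v_def and gh = g_def h_def
  have div: "a div ?k < ?n" "b div ?k < ?n"
    using ab by (simp_all add: less_mult_imp_div_less)
  have g: "g \<in> carrier G" and h: "h \<in> carrier G"
    using assms(7) k0 nth_mem[of "a mod ?k" gs] nth_mem[of "b mod ?k" gs] by (auto simp: gh)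
  have \<Psi>: "\<Psi> (u, v) \<in> carrier G" if "(u, v) \<in> parcs \<Gamma>"
    using assms(3) that by (auto simp: gain_graph_def)
  have "?R $$ (a, b) = (\<Sum>x\<in>carrier G. (?A $$ (a div ?k, b div ?k)) x *
      left_regular G gs x $$ (a mod ?k, b mod ?k))"
    unfolding k using assms(2) A reg ab by (rule index_fourier_transform)
  \<comment> \<open>The test \<open>x = \<Psi> (u, v)\<close> is put outermost so that the sum
    collapses to a single term.\<close>
  also have "\<dots> = (\<Sum>x\<in>carrier G.
      if x = \<Psi> (u, v) then if (u, v) \<in> parcs \<Gamma> \<and> x = g \<otimes>\<^bsub>G\<^esub> inv\<^bsub>G\<^esub> h then 1 else 0 else 0)"
    using div k0
    by (intro sum.cong)
       (auto simp: gain_adjacency_matrix_def left_regular_def group_elem_def group_algebra_def uv gh)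
  \<comment> \<open>The surviving index lies in the carrier when \<open>(u, v)\<close> is an arc;
    otherwise every term is 0.\<close>
  also have "\<dots> = (if (u, v) \<in> parcs \<Gamma> \<and> \<Psi> (u, v) = g \<otimes>\<^bsub>G\<^esub> inv\<^bsub>G\<^esub> h then 1 else 0)"
    using assms(2) \<Psi> by auto
  \<comment> \<open>Solving \<open>\<Psi> (u, v) = g h^-1\<close> for \<open>h\<close> gives the
    adjacency condition of the cover.\<close>
  also have "\<dots> = (if (u, v) \<in> parcs \<Gamma> \<and> h = inv\<^bsub>G\<^esub> \<Psi> (u, v) \<otimes>\<^bsub>G\<^esub> g then 1 else 0)"
    using inv_solve_left[OF h _ g] inv_solve_right[OF _ g h] \<Psi> by metis
  also have "\<dots> = ?L $$ (a, b)"
    using ab g h by (auto simp: adjacency_matrix_def cover_graph_def List.product_nth uv gh)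
  finally show "?L $$ (a, b) = ?R $$ (a, b)" by simp
qed

end
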